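(* If $G$ is a $(P_3+P_1)$-free graph, then every linear coloring of $G$ is a centered coloring. In particular, $\chi_{\mathrm{lin}}(G)=\chi_{\mathrm{cen}}(G)$.
   Context: All graphs are finite and simple. $P_3+P_1$ is the disjoint union of a path on 3 vertices and a single vertex; $G$ is $(P_3+P_1)$-free if no induced subgraph of $G$ is isomorphic to $P_3+P_1$. A centered coloring of $G$ assigns integers (colors) to vertices so that every connected subgraph contains a vertex whose color is unique in that subgraph; $\chi_{\mathrm{cen}}(G)$ is the minimum number of colors of such a coloring. A linear coloring requires the same only for every path of $G$ (as a subgraph); $\chi_{\mathrm{lin}}(G)$ is the minimum number of colors of a linear coloring. *)

theory Defs
  imports "Graph_Theory.Graph_Theory"
begin

text \<open>
  As in the locale \<^locale>\<open>graph\<close>, a finite simple graph is a finite loop-free symmetric digraph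
  without parallel arcs; an undirected edge is a pair of opposite arcs.
\<close>

definition P3_plus_P1 :: "nat pair_pre_digraph" where
  "P3_plus_P1 = \<lparr> pverts = {0, 1, 2, 3}, parcs = {(0, 1), (1, 0), (1, 2), (2, 1)} \<rparr>"

definition P3_plus_P1_free :: "('a, 'b) pre_digraph \<Rightarrow> bool" where
  "P3_plus_P1_free G \<longleftrightarrow>
     \<not> (\<exists>H. induced_subgraph H G \<and> digraph_iso (with_proj P3_plus_P1) H)"

definition has_unique_color :: "('a \<Rightarrow> int) \<Rightarrow> 'a set \<Rightarrow> bool" where
  "has_unique_color c S \<longleftrightarrow> (\<exists>v\<in>S. \<forall>u\<in>S. c u = c v \<longrightarrow> u = v)"

text \<open>
  The condition \<^prop>\<open>graph H\<close> excludes those sub-digraphs that contain an arc without its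
  reverse. The library's \<^const>\<open>connected\<close> and \<^const>\<open>vpath\<close> both exclude the empty
  graph and the empty path.
\<close>

definition centered_coloring :: "('a, 'b) pre_digraph \<Rightarrow> ('a \<Rightarrow> int) \<Rightarrow> bool" where
  "centered_coloring G c \<longleftrightarrow>
     (\<forall>H. graph H \<and> subgraph H G \<and> connected H \<longrightarrow> has_unique_color c (verts H))"

definition linear_coloring :: "('a, 'b) pre_digraph \<Rightarrow> ('a \<Rightarrow> int) \<Rightarrow> bool" where
  "linear_coloring G c \<longleftrightarrow> (\<forall>p. vpath p G \<longrightarrow> has_unique_color c (set p))"

definition chi_cen :: "('a, 'b) pre_digraph \<Rightarrow> nat" where
  "chi_cen G = (LEAST k. \<exists>c. centered_coloring G c \<and> card (c ` verts G) = k)"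

definition chi_lin :: "('a, 'b) pre_digraph \<Rightarrow> nat" where
  "chi_lin G = (LEAST k. \<exists>c. linear_coloring G c \<and> card (c ` verts G) = k)"

end

theory Submission
  imports Defs
begin

text \<open>
  Let \<open>c\<close> be a linear coloring in which no color is unique on a connected induced subgraph.
  Adjacent vertices have different colors. If the subgraph were a join of two nonempty parts, then a
  vertex \<open>a\<^sub>1\<close> of one part and a vertex \<open>d\<^sub>1\<close> of the other would share their colors
  with some \<open>a\<^sub>2\<close>, \<open>d\<^sub>2\<close> in the same respective parts, and the path
  \<open>a\<^sub>1 d\<^sub>1 a\<^sub>2 d\<^sub>2\<close> would contradict linearity. In a \<open>(P\<^sub>3 + P\<^sub>1)\<close>-free
  graph the vertices complete to an independent triple are joined to all other vertices, so no
  vertex is complete to an independent triple. If there is such a triple at all, this makes adjacency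
  transitive, so that the connected subgraph is complete, a contradiction. Hence the independence
  number is at most two, and a connected graph with this property has a Hamiltonian path, which
  again contradicts linearity.
\<close>

section \<open>Domination as the adjacency form of excluding P3 + P1\<close>

lemma (in graph) adj_sym: "u \<rightarrow> v \<Longrightarrow> v \<rightarrow> u"
  using arcs_ends_symmetric[OF sym_arcs] .

text \<open>Otherwise \<open>x\<close>, \<open>y\<close>, \<open>z\<close>, \<open>w\<close> induce
  a copy of P3 + P1. Only this adjacency form of freeness is used later; it restricts easily to
  induced subgraphs.\<close>

lemma (in graph) P3_plus_P1_free_dominates:
  assumes free: "P3_plus_P1_free G"
    and ab: "x \<rightarrow> y" and bc: "y \<rightarrow> z" and ac: "x \<noteq> z" "\<not> x \<rightarrow> z" and d: "w \<in> verts G"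
  shows "x \<rightarrow> w \<or> y \<rightarrow> w \<or> z \<rightarrow> w"
proof (rule ccontr)
  assume nd: "\<not> ?thesis"
  have neq: "x \<noteq> y" "y \<noteq> z" "w \<noteq> x" "w \<noteq> y" "w \<noteq> z"
    using ab bc nd adj_not_same adj_sym by blast+
  have non_adj: "\<not> v \<rightarrow> v" "\<not> x \<rightarrow> z" "\<not> z \<rightarrow> x" "\<not> x \<rightarrow> w" "\<not> w \<rightarrow> x" "\<not> y \<rightarrow> w"
    "\<not> w \<rightarrow> y" "\<not> z \<rightarrow> w" "\<not> w \<rightarrow> z" for v
    using nd ac adj_sym adj_not_same by blast+
  define f where "f = (!) [x, y, z, w]"
  have f: "f 0 = x" "f (Suc 0) = y" "f 2 = z" "f 3 = w"
    by (simp_all add: f_def numeral_3_eq_3 numeral_2_eq_2)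
  \<comment> \<open>Arcs of \<open>G\<close> are abstract objects, so the arc map has to choose, for
    each pair, an arc of \<open>G\<close> with the corresponding ends.\<close>
  define g where "g = (\<lambda>e. inv_into (arcs G) (arc_to_ends G) (map_prod f f e))"
  have g: "g (i, j) \<in> arcs G \<and> tail G (g (i, j)) = f i \<and> head G (g (i, j)) = f j"
    if "f i \<rightarrow> f j" for i j
  proof -
    have "(f i, f j) \<in> arc_to_ends G ` arcs G" using that by (simp add: arcs_ends_def)
    from inv_into_into[OF this] f_inv_into_f[OF this] show ?thesis
      by (simp add: g_def arc_to_ends_def)
  qed
  let ?P = "with_proj P3_plus_P1"
  let ?S = "{x, y, z, w}"
  let ?h = "\<lparr> iso_verts = f, iso_arcs = g, iso_head = head G, iso_tail = tail G \<rparr>"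
  have P: "verts ?P = {0, 1, 2, 3}" "arcs ?P = {(0, 1), (1, 0), (1, 2), (2, 1)}"
    "tail ?P = fst" "head ?P = snd"
    by (simp_all add: P3_plus_P1_def)
  have adj: "f 0 \<rightarrow> f 1" "f 1 \<rightarrow> f 0" "f 1 \<rightarrow> f 2" "f 2 \<rightarrow> f 1"
    using ab bc adj_sym by (simp_all add: f)
  note gs = adj[THEN g]
  have S: "?S \<subseteq> verts G" using ab bc d adj_in_verts by blast
  have "digraph_iso ?P (G \<restriction> ?S)"
    unfolding digraph_iso_def
  proof (intro exI conjI)
    have "wf_digraph ?P" by unfold_locales (auto simp: P3_plus_P1_def)
    moreover have inj: "inj_on f (verts ?P)" using neq ac unfolding P inj_on_def by (auto simp: f)
    moreover have "inj_on g (arcs ?P)"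
    proof (rule inj_onI)
      fix e e' assume e: "e \<in> arcs ?P" "e' \<in> arcs ?P" "g e = g e'"
      have ends: "arc_to_ends G (g e) = map_prod f f e" if "e \<in> arcs ?P" for e
        using that gs unfolding P by (auto simp: arc_to_ends_def)
      have "map_prod f f e = map_prod f f e'" using ends e by metis
      moreover have "e \<in> verts ?P \<times> verts ?P" "e' \<in> verts ?P \<times> verts ?P"
        using e(1,2) unfolding P by auto
      ultimately show "e = e'"
        using inj_onD[OF map_prod_inj_on[OF inj inj]] by blast
    qed
    ultimately show "pre_digraph.digraph_isomorphism ?P ?h"
      unfolding pre_digraph.digraph_isomorphism_def P using gs by auto
    have "arcs (G \<restriction> ?S) = g ` arcs ?P"
    proof
      show "g ` arcs ?P \<subseteq> arcs (G \<restriction> ?S)"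
        unfolding P using gs f by auto
    next
      show "arcs (G \<restriction> ?S) \<subseteq> g ` arcs ?P"
      proof
        fix e assume "e \<in> arcs (G \<restriction> ?S)"
        then have e: "e \<in> arcs G" "tail G e \<in> ?S" "head G e \<in> ?S" by auto
        have te: "tail G e \<rightarrow> head G e" using e(1) by (auto simp: arcs_ends_conv)
        have "(tail G e, head G e) \<in> {(x, y), (y, x), (y, z), (z, y)}"
          using e(2,3) te non_adj by (elim insertE emptyE) simp_all
        then obtain i j where ij: "(i, j) \<in> arcs ?P" "tail G e = f i" "head G e = f j"
          unfolding P using f by auto
        then have "arc_to_ends G e = arc_to_ends G (g (i, j)) \<and> g (i, j) \<in> arcs G"
          using g te by (simp add: arc_to_ends_def)
        \<comment> \<open>The chosen arc is the only one with these ends, hence \<open>g\<close>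
          reaches every arc of the induced subgraph.\<close>
        then have "e = g (i, j)" using e no_multi_arcs by blast
        then show "e \<in> g ` arcs ?P" using ij by blast
      qed
    qed
    then show "G \<restriction> ?S = app_iso ?h ?P"
      by (intro pre_digraph.equality) (auto simp: P3_plus_P1_def f)
  qed
  then show False using free induced_induce[OF S] unfolding P3_plus_P1_free_def by blast
qed

section \<open>Connectivity and Hamiltonian paths\<close>

lemma (in graph) graph_induce_subgraph:
  assumes "S \<subseteq> verts G"
  shows "graph (G \<restriction> S)"
proof -
  interpret D: digraph "G \<restriction> S" using digraphI_induced induced_induce[OF assms] .
  show ?thesis
    using induced_graph_imp_symmetric[OF sym_arcs induced_induce[OF assms]] by (rule D.graphI)
qed

lemma (in graph) connected_iff_reachable:
  "connected G \<longleftrightarrow> verts G \<noteq> {} \<and> (\<forall>u\<in>verts G. \<forall>v\<in>verts G. u \<rightarrow>\<^sup>* v)"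
  by (simp add: connected_def strongly_connected_def reachable_mk_symmetric_eq[OF sym_arcs])

lemma (in graph) connected_crossing_arc:
  assumes "connected G" and X: "X \<subseteq> verts G" "X \<noteq> {}" "X \<noteq> verts G"
  obtains u v where "u \<in> X" "v \<in> verts G - X" "u \<rightarrow> v"
proof -
  obtain a b where ab: "a \<in> X" "b \<in> verts G - X" using X by blast
  then have "a \<rightarrow>\<^sup>* b" using assms connected_iff_reachable by auto
  then have "b \<in> X" if "\<And>u v. u \<in> X \<Longrightarrow> u \<rightarrow> v \<Longrightarrow> v \<in> X"
    using ab(1) that by (induct rule: reachable_induct) auto
  then show thesis using ab that adj_in_verts by blast
qed

text \<open>Suppose a longest path misses a neighbor \<open>x\<close> of one of its vertices
  \<open>u\<close>. Neither end is adjacent to \<open>x\<close>, so the two ends are adjacent and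
  close the path to a cycle. Opening the cycle at \<open>u\<close> and prepending \<open>x\<close>
  gives a longer path.\<close>

lemma (in graph) connected_independence_le2_hamiltonian_path:
  assumes con: "connected G"
    and alpha: "\<And>x y z. \<lbrakk>x \<in> verts G; y \<in> verts G; z \<in> verts G; x \<noteq> y; y \<noteq> z; x \<noteq> z\<rbrakk>
      \<Longrightarrow> x \<rightarrow> y \<or> y \<rightarrow> z \<or> x \<rightarrow> z"
  obtains p where "vpath p G" "set p = verts G"
proof -
  obtain v where v: "v \<in> verts G" using con connected_iff_reachable by auto
  have "length p \<le> card (verts G)" if "vpath p G" for p
    using that card_mono[of "verts G" "set p"] distinct_card[of p]
    by (simp add: vpath_def vwalk_def)
  then have "\<forall>p. vpath p G \<longrightarrow> length p < Suc (card (verts G))"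
    by (simp add: less_Suc_eq_le)
  then obtain p where p: "vpath p G" and max: "\<And>q. vpath q G \<Longrightarrow> length q \<le> length p"
    using ex_has_greatest_nat[of "\<lambda>p. vpath p G" "[v]" length "Suc (card (verts G))"]
      vpath_self[OF v] by blast
  have pne: "p \<noteq> []" and pd: "distinct p" and ps: "set p \<subseteq> verts G" and pw: "vwalk p G"
    using p by (simp_all add: vpath_def vwalk_def)
  have "set p = verts G"
  proof (rule ccontr)
    assume "set p \<noteq> verts G"
    moreover have "set p \<noteq> {}" using pne by simp
    ultimately obtain u x where u: "u \<in> set p" and "x \<in> verts G - set p" and ux: "u \<rightarrow> x"
      using connected_crossing_arc[OF con ps] by metis
    then have x: "x \<in> verts G" "x \<notin> set p" by auto
    \<comment> \<open>Stated for every path on the vertex set of \<open>p\<close>, to be applied to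
      \<open>p\<close>, to its reversal and to its rotation starting at \<open>u\<close>.\<close>
    have no_ext: "\<not> x \<rightarrow> hd q" if "vwalk q G" "distinct q" "set q = set p" for q
    proof
      assume "x \<rightarrow> hd q"
      then have "vpath (x # q) G"
        using that x vwalk_consI[OF that(1) x(1)] by (simp add: vpath_def)
      moreover have "length q = length p" using that pd by (metis distinct_card)
      ultimately show False using max[of "x # q"] by simp
    qed
    have rev: "vwalk (rev p) G"
      using pw by (auto simp: vwalk_def set_vwalk_arcs_rev intro: adj_sym)
    have nh: "\<not> x \<rightarrow> hd p" using no_ext[OF pw pd] by simp
    have nl: "\<not> x \<rightarrow> last p" using no_ext[OF rev] pd pne by (simp add: hd_rev)
    \<comment> \<open>The independence hypothesis needs three distinct vertices. If the ends
      coincide, \<open>p\<close> consists of \<open>u\<close> alone, which is adjacent to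
      \<open>x\<close>.\<close>
    have hl: "hd p \<noteq> last p"
    proof
      assume "hd p = last p"
      then have "u = hd p" using pd u by (cases p) (auto split: if_splits)
      then show False using nh ux adj_sym by blast
    qed
    have "hd p \<rightarrow> last p"
      using alpha[of x "hd p" "last p"] x nh nl hl ps hd_in_set[OF pne] last_in_set[OF pne]
      by blast
    then have close: "last p \<rightarrow> hd p" by (rule adj_sym)
    obtain as bs where split: "p = as @ u # bs" using u by (meson split_list)
    have "vwalk ((u # bs) @ as) G"
    proof (cases "as = []")
      case True
      then show ?thesis using pw split by simp
    next
      case False
      \<comment> \<open>The only arc of the rotation that is not in \<open>p\<close> is the closing
        one.\<close>
      have "vwalk_arcs ((u # bs) @ as) = vwalk_arcs (u # bs) @ (last p, hd p) # vwalk_arcs as"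
        using False split by (subst vwalk_arcs_append) auto
      moreover have "vwalk as G" "vwalk (u # bs) G"
        using vwalkI_append_l[of as "u # bs" G] vwalkI_append_r[of "u # bs" as G] False pw split
        by simp_all
      ultimately have "set (vwalk_arcs ((u # bs) @ as)) \<subseteq> arcs_ends G"
        using close by (simp add: vwalk_def)
      then show ?thesis using ps split by (simp add: vwalk_def)
    qed
    then have "\<not> x \<rightarrow> hd ((u # bs) @ as)"
      by (rule no_ext) (use pd split in auto)
    then show False using adj_sym[OF ux] by simp
  qed
  then show thesis using that p by blast
qed

section \<open>Linear colorings and unique colors\<close>

lemma (in graph) linear_coloring_adj_neq:
  assumes "linear_coloring G c" "u \<rightarrow> v"
  shows "c u \<noteq> c v"
proof -
  have "u \<noteq> v" using assms(2) adj_not_same by blast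
  then have "vpath [u, v] G" using assms(2) adj_in_verts by auto
  then have "has_unique_color c (set [u, v])"
    using assms(1) unfolding linear_coloring_def by blast
  then show ?thesis using \<open>u \<noteq> v\<close> by (auto simp: has_unique_color_def)
qed

text \<open>
  The vertices with at most one neighbor in the triple and those with three neighbors in it form
  a join; two neighbors are excluded by \<open>(P\<^sub>3 + P\<^sub>1)\<close>-freeness.
\<close>

lemma (in graph) no_vertex_complete_to_triple:
  assumes P: "\<And>x y z w. \<lbrakk>x \<rightarrow> y; y \<rightarrow> z; x \<noteq> z; \<not> x \<rightarrow> z; w \<in> verts G\<rbrakk>
      \<Longrightarrow> x \<rightarrow> w \<or> y \<rightarrow> w \<or> z \<rightarrow> w"
    and lin: "linear_coloring G c" and nuc: "\<not> has_unique_color c (verts G)"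
    and t: "x \<in> verts G" "y \<in> verts G" "z \<in> verts G" "x \<noteq> y" "y \<noteq> z" "x \<noteq> z"
      "\<not> x \<rightarrow> y" "\<not> y \<rightarrow> z" "\<not> x \<rightarrow> z"
    and d: "d \<rightarrow> x" "d \<rightarrow> y" "d \<rightarrow> z"
  shows False
proof -
  define D where "D = {v \<in> verts G. v \<rightarrow> x \<and> v \<rightarrow> y \<and> v \<rightarrow> z}"
  have join: "v \<rightarrow> u" if v: "v \<in> D" and u: "u \<in> verts G" "u \<notin> D" for u v
  proof (rule ccontr)
    assume nvu: "\<not> v \<rightarrow> u"
    have vt: "v \<rightarrow> x" "v \<rightarrow> y" "v \<rightarrow> z" using v by (auto simp: D_def)
    note tv = vt[THEN adj_sym]
    \<comment> \<open>Any two of \<open>x\<close>, \<open>y\<close>, \<open>z\<close> are the ends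
      of an induced path with middle \<open>v\<close>. As \<open>v\<close> misses \<open>u\<close>,
      one of the two ends must see \<open>u\<close>; so \<open>u\<close> sees at least two of the
      triple.\<close>
    have "x \<rightarrow> u \<or> y \<rightarrow> u" "y \<rightarrow> u \<or> z \<rightarrow> u" "x \<rightarrow> u \<or> z \<rightarrow> u"
      using P[OF tv(1) vt(2) t(4,7) u(1)] P[OF tv(2) vt(3) t(5,8) u(1)]
        P[OF tv(1) vt(3) t(6,9) u(1)] nvu by simp_all
    moreover have "x \<rightarrow> u \<Longrightarrow> y \<rightarrow> u \<Longrightarrow> z \<rightarrow> u" "y \<rightarrow> u \<Longrightarrow> z \<rightarrow> u \<Longrightarrow> x \<rightarrow> u"
      "x \<rightarrow> u \<Longrightarrow> z \<rightarrow> u \<Longrightarrow> y \<rightarrow> u"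
      using P[of x u y z] P[of y u z x] P[of x u z y] t adj_sym[of y u] adj_sym[of z u]
        adj_sym[of u x] adj_sym[of u y] adj_sym[of u z] adj_sym[of y x] adj_sym[of z x]
        adj_sym[of z y] by argo+
    ultimately have "x \<rightarrow> u" "y \<rightarrow> u" "z \<rightarrow> u" by argo+
    then show False using u adj_sym[of x u] adj_sym[of y u] adj_sym[of z u] by (simp add: D_def)
  qed
  have dup: "\<exists>w\<in>verts G. w \<noteq> v \<and> c w = c v" if "v \<in> verts G" for v
    using nuc that unfolding has_unique_color_def by blast
  have dD: "d \<in> D" using d adj_in_verts(1)[OF d(1)] by (simp add: D_def)
  have xD: "x \<notin> D" using adj_not_same[of x] by (auto simp: D_def)
  obtain d' where d': "d' \<in> verts G" "d' \<noteq> d" "c d' = c d"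
    using dup[OF adj_in_verts(1)[OF d(1)]] by blast
  obtain x' where x': "x' \<in> verts G" "x' \<noteq> x" "c x' = c x"
    using dup[OF t(1)] by blast
  \<comment> \<open>Equally colored vertices are nonadjacent, so the join puts \<open>d'\<close> on
    the side of \<open>d\<close>, and likewise \<open>x'\<close> on the side of
    \<open>x\<close>.\<close>
  have d'D: "d' \<in> D" using join[OF dD d'(1)] linear_coloring_adj_neq[OF lin, of d d'] d'(3) by auto
  have x'D: "x' \<notin> D"
    using join[of x' x] linear_coloring_adj_neq[OF lin, of x' x] x'(3) xD t(1) by auto
  have "x \<rightarrow> d" "d \<rightarrow> x'" "x' \<rightarrow> d'"
    using adj_sym[OF d(1)] join[OF dD x'(1) x'D] join[OF d'D x'(1) x'D, THEN adj_sym] by simp_all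
  moreover have "distinct [x, d, x', d']" using dD d'D xD x'D d'(2) x'(2) by auto
  ultimately have "vpath [x, d, x', d'] G"
    using t(1) x'(1) d'(1) dD by (simp add: vpath_def vwalk_def D_def)
  then have "has_unique_color c (set [x, d, x', d'])"
    using lin unfolding linear_coloring_def by blast
  then show False using d' x' by (auto simp: has_unique_color_def)
qed

text \<open>The core argument, to be applied to the subgraph induced by the vertices of a connected
  subgraph.\<close>

lemma (in graph) linear_coloring_unique_color:
  assumes con: "connected G" and lin: "linear_coloring G c"
    and P: "\<And>x y z w. \<lbrakk>x \<rightarrow> y; y \<rightarrow> z; x \<noteq> z; \<not> x \<rightarrow> z; w \<in> verts G\<rbrakk>
      \<Longrightarrow> x \<rightarrow> w \<or> y \<rightarrow> w \<or> z \<rightarrow> w"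
  shows "has_unique_color c (verts G)"
proof (rule ccontr)
  assume nuc: "\<not> ?thesis"
  define indep where "indep x y z \<longleftrightarrow> {x, y, z} \<subseteq> verts G \<and> x \<noteq> y \<and> y \<noteq> z \<and> x \<noteq> z
    \<and> \<not> x \<rightarrow> y \<and> \<not> y \<rightarrow> z \<and> \<not> x \<rightarrow> z" for x y z
  have no3: "\<not> (v \<rightarrow> x \<and> v \<rightarrow> y \<and> v \<rightarrow> z)" if "indep x y z" for x y z v
    using no_vertex_complete_to_triple[OF P lin nuc, of x y z v] that
    unfolding indep_def by blast
  \<comment> \<open>If \<open>v\<close> sees \<open>x\<close> and \<open>y\<close>, then the path
    \<open>x\<close>, \<open>v\<close>, \<open>y\<close> dominates \<open>z\<close>, which only
    \<open>v\<close> can see; this contradicts \<open>no3\<close>.\<close>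
  have no2: "\<not> (v \<rightarrow> x \<and> v \<rightarrow> y)" if "indep x y z" for x y z v
    using no3[OF that, of v] P[of x v y z] that adj_sym[of v x] adj_sym[of x z] adj_sym[of y z]
    unfolding indep_def by auto
  have "\<not> indep r s t" for r s t
  proof
    assume T: "indep r s t"
    have le1: "\<not> (v \<rightarrow> r \<and> v \<rightarrow> s)" "\<not> (v \<rightarrow> r \<and> v \<rightarrow> t)" "\<not> (v \<rightarrow> s \<and> v \<rightarrow> t)" for v
      using no2[of r s t v] no2[of r t s v] no2[of s t r v] T adj_sym[of t s] adj_sym[of s r]
        adj_sym[of t r]
      unfolding indep_def by auto
    have trans: "x \<rightarrow> z" if xy: "x \<rightarrow> y" and yz: "y \<rightarrow> z" and ne: "x \<noteq> z" for x y z
    proof (rule ccontr)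
      assume xz: "\<not> x \<rightarrow> z"
      \<comment> \<open>Each of \<open>x\<close> and \<open>z\<close> rules out at most one member
        of the triple: itself if it belongs to the triple, otherwise its possible single neighbor
        there. The remaining \<open>q\<close> forms an independent triple with \<open>x\<close> and
        \<open>z\<close>, whose common neighbor \<open>y\<close> contradicts
        \<open>no2\<close>.\<close>
      have "\<exists>q\<in>{r, s, t}. q \<noteq> x \<and> q \<noteq> z \<and> \<not> x \<rightarrow> q \<and> \<not> z \<rightarrow> q"
        using le1[of x] le1[of z] T adj_sym[of s r] adj_sym[of t r] adj_sym[of t s] ne
        unfolding indep_def by auto
      then obtain q where "indep x z q"
        using T ne xz adj_in_verts[OF xy] adj_in_verts[OF yz] unfolding indep_def by auto
      then show False using no2 adj_sym[OF xy] yz by blast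
    qed
    have "r \<rightarrow>\<^sup>* s" using con T connected_iff_reachable unfolding indep_def by auto
    then have "r = s \<or> r \<rightarrow> s"
      by (induct rule: reachable_induct) (use trans in blast)+
    then show False using T unfolding indep_def by blast
  qed
  then obtain p where "vpath p G" "set p = verts G"
    using connected_independence_le2_hamiltonian_path[OF con] unfolding indep_def by blast
  then show False using lin nuc unfolding linear_coloring_def by metis
qed

section \<open>Reduction to induced subgraphs\<close>

lemma (in graph) connected_induce_subgraph:
  assumes "graph H" "subgraph H G" "connected H"
  shows "connected (G \<restriction> verts H)"
proof -
  have S: "verts H \<subseteq> verts G" using assms(2) by auto
  interpret H: graph H by fact
  interpret K: graph "G \<restriction> verts H" using graph_induce_subgraph[OF S] .
  have "subgraph H (G \<restriction> verts H)" using assms(2) subgraph_induce_subgraphI2 by blast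
  then have "u \<rightarrow>\<^sup>*\<^bsub>G \<restriction> verts H\<^esub> v" if "u \<rightarrow>\<^sup>*\<^bsub>H\<^esub> v" for u v
    using that K.reachable_mono by blast
  then show ?thesis
    using assms(3) unfolding H.connected_iff_reachable K.connected_iff_reachable by auto
qed

lemma (in graph) vpath_connected_induce_subgraph:
  assumes "vpath p G"
  shows "connected (G \<restriction> set p)"
proof -
  have S: "set p \<subseteq> verts G" using assms by auto
  interpret K: graph "G \<restriction> set p" using graph_induce_subgraph[OF S] .
  have adj: "u \<rightarrow>\<^bsub>G \<restriction> set p\<^esub> v" if "u \<rightarrow> v" "u \<in> set p" "v \<in> set p" for u v
    using that by (auto simp: arcs_ends_conv)
  have "set (vwalk_arcs p) \<subseteq> arcs_ends G" using assms by auto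
  then have "set (vwalk_arcs p) \<subseteq> arcs_ends (G \<restriction> set p)"
    using adj arcs_in_vwalk_arcs[of _ p] by auto
  then have w: "vwalk p (G \<restriction> set p)"
    using assms by (intro vwalkI) auto
  \<comment> \<open>The prefix of \<open>p\<close> ending in \<open>v\<close> is a walk from
    \<open>hd p\<close>; symmetry then connects any two vertices through
    \<open>hd p\<close>.\<close>
  have "hd p \<rightarrow>\<^sup>*\<^bsub>G \<restriction> set p\<^esub> v" if v: "v \<in> set p" for v
  proof -
    obtain as bs where p: "p = (as @ [v]) @ bs"
      using split_list[OF v] by auto
    then have "vwalk (as @ [v]) (G \<restriction> set p)"
      using w vwalkI_append_l by (metis snoc_eq_iff_butlast)
    moreover have "hd (as @ [v]) = hd p" using p by (cases as) auto
    ultimately show ?thesis unfolding K.reachable_vwalk_conv by (metis last_snoc)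
  qed
  then have "u \<rightarrow>\<^sup>*\<^bsub>G \<restriction> set p\<^esub> v" if "u \<in> set p" "v \<in> set p" for u v
    using that K.reachable_trans symmetric_reachable[OF K.sym_arcs] by blast
  moreover have "p \<noteq> []" using assms by auto
  ultimately show ?thesis by (simp add: K.connected_iff_reachable)
qed

lemma (in graph) centered_coloring_imp_linear_coloring:
  assumes "centered_coloring G c"
  shows "linear_coloring G c"
  unfolding linear_coloring_def
proof (intro allI impI)
  fix p assume p: "vpath p G"
  then have S: "set p \<subseteq> verts G" by auto
  show "has_unique_color c (set p)"
    using assms graph_induce_subgraph[OF S] subgraph_induce_subgraphI[OF S]
      vpath_connected_induce_subgraph[OF p]
    unfolding centered_coloring_def by fastforce
qed

text \<open>Whether a color is unique depends only on the vertex set, so \<open>H\<close> may be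
  replaced by the subgraph induced on its vertices. That subgraph stays connected and inherits
  linearity and domination.\<close>

lemma (in graph) linear_coloring_imp_centered_coloring:
  assumes free: "P3_plus_P1_free G" and lin: "linear_coloring G c"
  shows "centered_coloring G c"
  unfolding centered_coloring_def
proof (intro allI impI, elim conjE)
  fix H assume H: "graph H" "subgraph H G" "connected H"
  let ?K = "G \<restriction> verts H"
  have S: "verts H \<subseteq> verts G" using H(2) by auto
  interpret K: graph ?K using graph_induce_subgraph[OF S] .
  have adj: "u \<rightarrow>\<^bsub>?K\<^esub> v \<longleftrightarrow> u \<rightarrow> v \<and> u \<in> verts H \<and> v \<in> verts H" for u v
    by (auto simp: arcs_ends_conv)
  have "linear_coloring ?K c"
    using lin vpathI_subgraph[OF _ subgraph_induce_subgraphI[OF S]]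
    unfolding linear_coloring_def by blast
  moreover have "x \<rightarrow>\<^bsub>?K\<^esub> w \<or> y \<rightarrow>\<^bsub>?K\<^esub> w \<or> z \<rightarrow>\<^bsub>?K\<^esub> w"
    if "x \<rightarrow>\<^bsub>?K\<^esub> y" "y \<rightarrow>\<^bsub>?K\<^esub> z" "x \<noteq> z" "\<not> x \<rightarrow>\<^bsub>?K\<^esub> z" "w \<in> verts ?K" for x y z w
    using that P3_plus_P1_free_dominates[OF free, of x y z w] S unfolding adj by auto
  ultimately have "has_unique_color c (verts ?K)"
    using K.linear_coloring_unique_color[OF connected_induce_subgraph[OF H]] by blast
  then show "has_unique_color c (verts H)" by simp
qed

theorem theorem4p2:
  fixes G :: "('a, 'b) pre_digraph"
  assumes "graph G" and "P3_plus_P1_free G"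
  shows "(\<forall>c. linear_coloring G c \<longrightarrow> centered_coloring G c) \<and> chi_lin G = chi_cen G"
proof -
  interpret graph G by fact
  have "linear_coloring G c \<longleftrightarrow> centered_coloring G c" for c
    using linear_coloring_imp_centered_coloring[OF assms(2)] centered_coloring_imp_linear_coloring
    by blast
  then show ?thesis by (simp add: chi_lin_def chi_cen_def)
qed

end
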